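(* For an arbitrary snark $G$, the following statements are equivalent: (i) $G$ is bicritical; (ii) $G$ is $4$-vertex-critical; (iii) $G$ is $7$-irreducible; (iv) $G$ is irreducible.
   Context: Graphs may have parallel edges and loops. A snark is a connected cubic graph that admits no proper edge-colouring with three colours (equivalently, no nowhere-zero $4$-flow). For distinct vertices $u,v$ of $G$, $G-\{u,v\}$ denotes the graph obtained by removing $u$ and $v$ but retaining the edges formerly incident with them as dangling edges, and $G/\{u,v\}$ denotes the graph obtained by identifying $u$ and $v$. A snark $G$ is bicritical if $G-\{u,v\}$ is $3$-edge-colourable for every pair of distinct vertices $u,v$. A snark $G$ is $4$-vertex-critical if $G/\{u,v\}$ admits a nowhere-zero $4$-flow for every pair of distinct vertices $u,v$. For an integer $k\ge1$, a snark $G$ is $k$-irreducible if removing fewer than $k$ edges from $G$ never produces a component of chromatic index $4$ that can be completed (by adding vertices and edges) to a cubic graph $H$ with fewer vertices than $G$; $G$ is irreducible if it is $k$-irreducible for every $k\ge1$.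
   Formalization: In k-irreducibility, "component of chromatic index 4" also includes components containing a loop (no proper edge-colouring, index infinite); read literally the claim fails for the claw with a loop at each leaf. For loopless snarks nothing changes. *)

theory Defs
  imports Main "HOL-Library.Multiset" "HOL-Library.Extended_Nat"
begin

text \<open>
  Undirected multigraphs, possibly with dangling edges (multipoles). Each edge carries the
  multiset of the vertices at its ends: \<open>{#x, y#}\<close> for an ordinary edge, \<open>{#x, x#}\<close> for a loop,
  \<open>{#x#}\<close> for an edge dangling at one end and \<open>{#}\<close> for an edge dangling at both ends.
\<close>

record ('v, 'e) multipole =
  verts :: "'v set"
  edges :: "'e set"
  ends :: "'e \<Rightarrow> 'v multiset"

definition graph :: "('v, 'e) multipole \<Rightarrow> bool" where
  "graph G \<longleftrightarrow> finite (verts G) \<and> finite (edges G) \<and>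
     (\<forall>e\<in>edges G. size (ends G e) = 2 \<and> set_mset (ends G e) \<subseteq> verts G)"

text \<open>A loop contributes 2 to the degree of its vertex.\<close>

definition degree :: "('v, 'e) multipole \<Rightarrow> 'v \<Rightarrow> nat" where
  "degree G v = (\<Sum>e\<in>edges G. count (ends G e) v)"

definition cubic_graph :: "('v, 'e) multipole \<Rightarrow> bool" where
  "cubic_graph G \<longleftrightarrow> graph G \<and> (\<forall>v\<in>verts G. degree G v = 3)"

definition adjacent :: "('v, 'e) multipole \<Rightarrow> 'v \<Rightarrow> 'v \<Rightarrow> bool" where
  "adjacent G x y \<longleftrightarrow> (\<exists>e\<in>edges G. ends G e = {#x, y#})"

definition connected :: "('v, 'e) multipole \<Rightarrow> bool" where
  "connected G \<longleftrightarrow> verts G \<noteq> {} \<and> (\<forall>x\<in>verts G. \<forall>y\<in>verts G. (adjacent G)\<^sup>*\<^sup>* x y)"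

definition component_of :: "('v, 'e) multipole \<Rightarrow> 'v \<Rightarrow> ('v, 'e) multipole" where
  "component_of G x =
     (let C = {y \<in> verts G. (adjacent G)\<^sup>*\<^sup>* x y}
      in \<lparr>verts = C, edges = {e \<in> edges G. set_mset (ends G e) \<subseteq> C}, ends = ends G\<rparr>)"

definition components :: "('v, 'e) multipole \<Rightarrow> ('v, 'e) multipole set" where
  "components G = component_of G ` verts G"

text \<open>
  A loop is adjacent to itself, so a multipole with a loop has no proper edge-colouring. This is
  the convention under which a cubic graph is 3-edge-colourable iff it has a nowhere-zero 4-flow.
\<close>

definition proper_edge_colouring :: "nat \<Rightarrow> ('v, 'e) multipole \<Rightarrow> ('e \<Rightarrow> nat) \<Rightarrow> bool" where
  "proper_edge_colouring k M c \<longleftrightarrow>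
     (\<forall>e\<in>edges M. c e < k) \<and>
     (\<forall>e\<in>edges M. \<forall>v. count (ends M e) v \<le> 1) \<and>
     (\<forall>e\<in>edges M. \<forall>f\<in>edges M. e \<noteq> f \<and> set_mset (ends M e) \<inter> set_mset (ends M f) \<noteq> {}
        \<longrightarrow> c e \<noteq> c f)"

definition edge_colourable :: "nat \<Rightarrow> ('v, 'e) multipole \<Rightarrow> bool" where
  "edge_colourable k M \<longleftrightarrow> (\<exists>c. proper_edge_colouring k M c)"

text \<open>For a finite multipole the value is \<open>\<infinity>\<close> exactly if there is a loop.\<close>

definition chromatic_index :: "('v, 'e) multipole \<Rightarrow> enat" where
  "chromatic_index M = Inf (enat ` {k. edge_colourable k M})"

definition nowhere_zero_flow :: "nat \<Rightarrow> ('v, 'e) multipole \<Rightarrow> bool" where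
  "nowhere_zero_flow k G \<longleftrightarrow>
     (\<exists>(tail :: 'e \<Rightarrow> 'v) (head :: 'e \<Rightarrow> 'v) (\<phi> :: 'e \<Rightarrow> int).
        (\<forall>e\<in>edges G. ends G e = {#tail e, head e#}) \<and>
        (\<forall>e\<in>edges G. \<phi> e \<noteq> 0 \<and> \<bar>\<phi> e\<bar> < int k) \<and>
        (\<forall>v\<in>verts G. (\<Sum>e\<in>{e \<in> edges G. head e = v}. \<phi> e) =
                      (\<Sum>e\<in>{e \<in> edges G. tail e = v}. \<phi> e)))"

definition snark :: "('v, 'e) multipole \<Rightarrow> bool" where
  "snark G \<longleftrightarrow> cubic_graph G \<and> connected G \<and> \<not> edge_colourable 3 G"

definition remove_verts :: "('v, 'e) multipole \<Rightarrow> 'v set \<Rightarrow> ('v, 'e) multipole" where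
  "remove_verts G X =
     \<lparr>verts = verts G - X, edges = edges G, ends = (\<lambda>e. filter_mset (\<lambda>x. x \<notin> X) (ends G e))\<rparr>"

definition identify :: "('v, 'e) multipole \<Rightarrow> 'v \<Rightarrow> 'v \<Rightarrow> ('v, 'e) multipole" where
  "identify G u v =
     (let q = (\<lambda>x. if x = v then u else x)
      in \<lparr>verts = q ` verts G, edges = edges G, ends = (\<lambda>e. image_mset q (ends G e))\<rparr>)"

definition remove_edges :: "('v, 'e) multipole \<Rightarrow> 'e set \<Rightarrow> ('v, 'e) multipole" where
  "remove_edges G S = \<lparr>verts = verts G, edges = edges G - S, ends = ends G\<rparr>"

definition bicritical :: "('v, 'e) multipole \<Rightarrow> bool" where
  "bicritical G \<longleftrightarrow>
     (\<forall>u\<in>verts G. \<forall>v\<in>verts G. u \<noteq> v \<longrightarrow> edge_colourable 3 (remove_verts G {u, v}))"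

definition four_vertex_critical :: "('v, 'e) multipole \<Rightarrow> bool" where
  "four_vertex_critical G \<longleftrightarrow>
     (\<forall>u\<in>verts G. \<forall>v\<in>verts G. u \<noteq> v \<longrightarrow> nowhere_zero_flow 4 (identify G u v))"

definition completes :: "('v, 'e) multipole \<Rightarrow> ('v, 'e) multipole \<Rightarrow> bool" where
  "completes H K \<longleftrightarrow> cubic_graph H \<and> verts K \<subseteq> verts H \<and> edges K \<subseteq> edges H \<and>
     (\<forall>e\<in>edges K. ends H e = ends K e)"

text \<open>
  A component containing a loop has chromatic index \<open>\<infinity>\<close>; it is not 3-edge-colourable and is
  treated like one of chromatic index 4.

  Letting \<open>H\<close> have the same vertex and edge types as \<open>G\<close> loses no generality, even if these types
  are finite: as \<open>H\<close> is cubic and has fewer vertices than the cubic graph \<open>G\<close>, it also has fewer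
  edges, so the elements of \<open>H\<close> outside \<open>K\<close> can be renamed to elements of \<open>G\<close> outside \<open>K\<close>.
\<close>

definition k_irreducible :: "nat \<Rightarrow> ('v, 'e) multipole \<Rightarrow> bool" where
  "k_irreducible k G \<longleftrightarrow>
     \<not> (\<exists>S K H. S \<subseteq> edges G \<and> card S < k \<and> K \<in> components (remove_edges G S) \<and>
          chromatic_index K \<in> {4, \<infinity>} \<and> completes H K \<and> card (verts H) < card (verts G))"

definition irreducible :: "('v, 'e) multipole \<Rightarrow> bool" where
  "irreducible G \<longleftrightarrow> (\<forall>k\<ge>1. k_irreducible k G)"

end

theory Submission imports Defs begin

text \<open>
  A nowhere-zero 4-flow amounts to a covering of the edges by two even subgraphs, and so does a
  3-edge-colouring of a cubic multipole: the even subgraphs are the unions of the colours 0, 1 and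
  of the colours 0, 2. Hence \<open>G / {u, v}\<close> has such a flow iff \<open>G - {u, v}\<close> is 3-edge-colourable,
  as the parity condition at the merged vertex follows from the others by handshaking.

  If \<open>G - {u, v}\<close> is not 3-edge-colourable, then neither is some component left after removing the
  at most six edges at \<open>u\<close> and \<open>v\<close>; greedy colouring shows that four colours suffice unless there
  is a loop, and joining up the missing degrees (with one extra vertex if the order is odd) gives a
  smaller cubic completion. Conversely, in a bicritical snark a component that is not
  3-edge-colourable misses at most one vertex, and as cubic graphs have even order it has no
  smaller completion.
\<close>

lemma size_2_mset_elim:
  assumes "size N = 2" "x \<in># N"
  obtains y where "N = {#x, y#}"
proof -
  have "size (N - {#x#}) = 1" using assms by (simp add: size_Diff_singleton)
  then obtain y where "N - {#x#} = {#y#}" using size_1_singleton_mset by blast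
  then have "N = {#x, y#}" using assms(2) by (metis insert_DiffM)
  then show ?thesis by (rule that)
qed

lemma size_2_mset_ex: "size N = 2 \<Longrightarrow> \<exists>x y. N = {#x, y#}"
  by (metis Suc_1 size_2_mset_elim size_eq_Suc_imp_elem)

lemma graph_edge_ex_end:
  assumes "graph G" "e \<in> edges G"
  shows "\<exists>x\<in>verts G. x \<in># ends G e"
  using assms size_2_mset_ex[of "ends G e"] by (force simp: graph_def)

lemma graph_edge_other_end:
  assumes "graph G" "e \<in> edges G" "x \<in># ends G e"
  obtains y where "ends G e = {#x, y#}" "x \<in> verts G" "y \<in> verts G"
proof -
  have "size (ends G e) = 2" and ends_subset: "set_mset (ends G e) \<subseteq> verts G"
    using assms(1,2) by (simp_all add: graph_def)
  from this(1) assms(3) obtain y where "ends G e = {#x, y#}" by (rule size_2_mset_elim)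
  with ends_subset show ?thesis using that by simp
qed

lemma doubleton_mset_eq_iff: "{#a, b#} = {#c, d#} \<longleftrightarrow> a = c \<and> b = d \<or> a = d \<and> b = c"
  by (auto simp: add_eq_conv_ex)

subsection \<open>Degrees in edge sets\<close>

definition degree_in :: "('v, 'e) multipole \<Rightarrow> 'e set \<Rightarrow> 'v \<Rightarrow> nat" where
  "degree_in M F x = (\<Sum>e\<in>F. count (ends M e) x)"

lemma degree_eq_degree_in: "degree M x = degree_in M (edges M) x"
  by (simp add: degree_def degree_in_def)

lemma degree_in_remove:
  assumes "finite F" "e \<in> F"
  shows "degree_in M F x = count (ends M e) x + degree_in M (F - {e}) x"
  using assms by (simp add: degree_in_def sum.remove)

lemma degree_in_Un_disjoint:
  assumes "finite P" "finite Q" "P \<inter> Q = {}"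
  shows "degree_in M (P \<union> Q) x = degree_in M P x + degree_in M Q x"
  using assms by (simp add: degree_in_def sum.union_disjoint)

lemma degree_in_mono:
  assumes "finite F" "F' \<subseteq> F"
  shows "degree_in M F' x \<le> degree_in M F x"
  unfolding degree_in_def by (rule sum_mono2) (use assms in auto)

lemma degree_in_eq_0:
  assumes "\<And>e. e \<in> F \<Longrightarrow> x \<notin># ends M e"
  shows "degree_in M F x = 0"
  using assms by (simp add: degree_in_def not_in_iff)

lemma sum_degree_in:
  assumes "finite V" "\<And>e. e \<in> F \<Longrightarrow> set_mset (ends M e) \<subseteq> V"
  shows "(\<Sum>x\<in>V. degree_in M F x) = (\<Sum>e\<in>F. size (ends M e))"
proof -
  have "(\<Sum>x\<in>V. count (ends M e) x) = size (ends M e)" if "e \<in> F" for e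
    unfolding size_multiset_overloaded_eq
    by (rule sum.mono_neutral_right) (use assms that in \<open>auto simp: not_in_iff\<close>)
  then show ?thesis
    unfolding degree_in_def by (subst sum.swap) simp
qed

lemma graph_sum_degree_in:
  assumes "graph G" "F \<subseteq> edges G"
  shows "(\<Sum>x\<in>verts G. degree_in G F x) = 2 * card F"
proof -
  have "(\<Sum>x\<in>verts G. degree_in G F x) = (\<Sum>e\<in>F. size (ends G e))"
    by (rule sum_degree_in) (use assms in \<open>auto simp: graph_def\<close>)
  also have "\<dots> = (\<Sum>e\<in>F. 2)"
    by (rule sum.cong) (use assms in \<open>auto simp: graph_def\<close>)
  finally show ?thesis by simp
qed

lemma cubic_graph_card:
  assumes "cubic_graph G"
  shows "3 * card (verts G) = 2 * card (edges G)"
  using graph_sum_degree_in[of G "edges G"] assms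
  by (simp add: cubic_graph_def flip: degree_eq_degree_in)

lemma cubic_graph_even_card:
  assumes "cubic_graph G"
  shows "even (card (verts G))"
  using cubic_graph_card[OF assms] by presburger

definition incident_edges :: "('v, 'e) multipole \<Rightarrow> 'e set \<Rightarrow> 'v set \<Rightarrow> 'e set" where
  "incident_edges M F X = {e \<in> F. set_mset (ends M e) \<inter> X \<noteq> {}}"

lemma card_incident_edges_le:
  assumes "finite F" "finite X"
  shows "card (incident_edges M F X) \<le> (\<Sum>x\<in>X. degree_in M F x)"
proof -
  have "incident_edges M F X = (\<Union>x\<in>X. {e \<in> F. x \<in># ends M e})"
    by (auto simp: incident_edges_def)
  then have "card (incident_edges M F X) \<le> (\<Sum>x\<in>X. card {e \<in> F. x \<in># ends M e})"
    using assms(2) by (simp add: card_UN_le)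
  also have "\<dots> \<le> (\<Sum>x\<in>X. degree_in M F x)"
  proof (rule sum_mono)
    fix x
    have "card {e \<in> F. x \<in># ends M e} = (\<Sum>e\<in>F. of_bool (x \<in># ends M e))"
      using assms(1) by (simp add: of_bool_def sum.inter_filter[symmetric])
    also have "\<dots> \<le> degree_in M F x"
      unfolding degree_in_def by (rule sum_mono) (simp add: Suc_le_eq)
    finally show "card {e \<in> F. x \<in># ends M e} \<le> degree_in M F x" .
  qed
  finally show ?thesis .
qed

subsection \<open>Balanced orientations\<close>

definition balanced_orientation ::
    "'e set \<Rightarrow> ('e \<Rightarrow> 'v multiset) \<Rightarrow> ('e \<Rightarrow> 'v) \<Rightarrow> ('e \<Rightarrow> 'v) \<Rightarrow> bool" where
  "balanced_orientation F N tail head \<longleftrightarrow>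
     (\<forall>e\<in>F. N e = {#tail e, head e#}) \<and> (\<Sum>e\<in>F. {#tail e#}) = (\<Sum>e\<in>F. {#head e#})"

lemma balanced_orientation_reverse:
  "balanced_orientation F N tail head \<Longrightarrow> balanced_orientation F N head tail"
  by (auto simp: balanced_orientation_def add_mset_commute)

lemma balanced_orientation_insert_loop:
  assumes "finite F" "e \<notin> F" "N e = {#x, x#}" "balanced_orientation F N tail head"
  shows "balanced_orientation (insert e F) N (tail(e := x)) (head(e := x))"
proof -
  have "(\<Sum>i\<in>F. {#(f(e := x)) i#}) = (\<Sum>i\<in>F. {#f i#})" for f :: "'a \<Rightarrow> 'b"
    using assms(2) by (intro sum.cong) auto
  then show ?thesis
    using assms by (auto simp: balanced_orientation_def)
qed

text \<open>
  Splitting off at \<open>x\<close> replaces two edges \<open>xy\<close> and \<open>xz\<close> by one edge \<open>yz\<close>; this keeps the parity of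
  all degrees.
\<close>

lemma balanced_orientation_undo_splitting:
  assumes "finite F" "e \<notin> F" "f \<in> F" "N e = {#x, y#}" "N f = {#x, z#}"
    and balanced: "balanced_orientation F (N(f := {#y, z#})) tail head" "tail f = y" "head f = z"
  shows "balanced_orientation (insert e F) N (tail(e := y, f := x)) (head(e := x))"
proof -
  have "e \<noteq> f" using assms(2,3) by blast
  have outside: "(\<Sum>i\<in>F - {f}. {#if i = e then a else g i#}) = (\<Sum>i\<in>F - {f}. {#g i#})"
    for g :: "'a \<Rightarrow> 'b" and a
    using assms(2) by (intro sum.cong) auto
  have "{#y#} + (\<Sum>i\<in>F - {f}. {#tail i#}) = {#z#} + (\<Sum>i\<in>F - {f}. {#head i#})"
    using balanced(1)
    unfolding balanced_orientation_def sum.remove[OF assms(1,3)] balanced(2,3) by blast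
  moreover have "\<forall>i\<in>F - {f}. N i = {#tail i, head i#}"
    using balanced(1) unfolding balanced_orientation_def
    by (metis Diff_iff fun_upd_other singletonI)
  ultimately show ?thesis
    using assms \<open>e \<noteq> f\<close>
    by (auto simp: balanced_orientation_def sum.remove[OF assms(1,3)] outside add_mset_commute)
qed

lemma ex_balanced_orientation_undo_splitting:
  assumes "finite F" "e \<notin> F" "f \<in> F" "N e = {#x, y#}" "N f = {#x, z#}"
    and balanced: "balanced_orientation F (N(f := {#y, z#})) tail head"
  shows "\<exists>tail' head'. balanced_orientation (insert e F) N tail' head'"
proof -
  have "{#tail f, head f#} = {#y, z#}"
    using balanced assms(3) by (auto simp: balanced_orientation_def)
  then have "tail f = y \<and> head f = z \<or> head f = y \<and> tail f = z"
    by (auto simp: doubleton_mset_eq_iff)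
  with balanced balanced_orientation_reverse[OF balanced]
  obtain tail' head' where "balanced_orientation F (N(f := {#y, z#})) tail' head'"
    "tail' f = y" "head' f = z"
    by blast
  from balanced_orientation_undo_splitting[OF assms(1-5) this] show ?thesis by blast
qed

lemma even_degree_ex_other_edge:
  assumes "finite F" "e \<notin> F" "N e = {#x, y#}" "x \<noteq> y"
    and "even (\<Sum>i\<in>insert e F. count (N i) x)"
  obtains f where "f \<in> F" "x \<in># N f"
proof (rule ccontr)
  assume "\<not> thesis"
  with that have "\<forall>f\<in>F. x \<notin># N f" by blast
  then have "(\<Sum>i\<in>F. count (N i) x) = 0" by (simp add: not_in_iff)
  with assms show False by simp
qed

lemma even_degree_splitting:
  assumes "finite F" "e \<notin> F" "f \<in> F" "N e = {#x, y#}" "N f = {#x, z#}"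
    and "even (\<Sum>i\<in>insert e F. count (N i) w)"
  shows "even (\<Sum>i\<in>F. count ((N(f := {#y, z#})) i) w)"
proof -
  have "(\<Sum>i\<in>F - {f}. count ((N(f := {#y, z#})) i) w) = (\<Sum>i\<in>F - {f}. count (N i) w)"
    by (rule sum.cong) auto
  then have "(\<Sum>i\<in>insert e F. count (N i) w) =
      2 * count {#x#} w + (\<Sum>i\<in>F. count ((N(f := {#y, z#})) i) w)"
    using assms(1,2,4,5) by (simp add: sum.remove[OF assms(1,3)])
  with assms(6) show ?thesis by (metis dvd_triv_left even_add)
qed

lemma even_degrees_imp_balanced_orientation:
  assumes "finite F" "\<And>e. e \<in> F \<Longrightarrow> size (N e) = 2" "\<And>x. even (\<Sum>e\<in>F. count (N e) x)"
  shows "\<exists>tail head. balanced_orientation F N tail head"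
  using assms
proof (induction F arbitrary: N rule: finite_psubset_induct)
  case (psubset F)
  show ?case
  proof (cases "F = {}")
    case True
    then show ?thesis by (simp add: balanced_orientation_def)
  next
    case False
    then obtain e F' where F: "F = insert e F'" "e \<notin> F'" by (metis ex_in_conv mk_disjoint_insert)
    then have "F' \<subset> F" "finite F'" using psubset.hyps by auto
    have size: "size (N i) = 2" if "i \<in> insert e F'" for i using psubset.prems(1) F(1) that by blast
    then obtain x y where ends_e: "N e = {#x, y#}" using size_2_mset_ex by blast
    have even: "even (\<Sum>i\<in>insert e F'. count (N i) w)" for w using psubset.prems(2) F(1) by simp
    show ?thesis
    proof (cases "x = y")
      case True
      then have "even (\<Sum>i\<in>F'. count (N i) w)" for w
        using even[of w] F(2) \<open>finite F'\<close> ends_e by (simp split: if_splits)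
      then obtain tail head where "balanced_orientation F' N tail head"
        using psubset.IH[OF \<open>F' \<subset> F\<close>, of N] size by blast
      from balanced_orientation_insert_loop[OF \<open>finite F'\<close> F(2) _ this]
      show ?thesis using ends_e True F(1) by blast
    next
      case False
      obtain f where f: "f \<in> F'" "x \<in># N f"
        by (rule even_degree_ex_other_edge[OF \<open>finite F'\<close> F(2) ends_e False even])
      have "size (N f) = 2" using size f(1) by blast
      then obtain z where ends_f: "N f = {#x, z#}" using f(2) by (rule size_2_mset_elim)
      note split_off = \<open>finite F'\<close> F(2) f(1) ends_e ends_f
      let ?N = "N(f := {#y, z#})"
      have "size (?N i) = 2" if "i \<in> F'" for i using size that by simp
      then obtain tail head where "balanced_orientation F' ?N tail head"
        using psubset.IH[OF \<open>F' \<subset> F\<close> _ even_degree_splitting[OF split_off even]] by blast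
      then show ?thesis
        using ex_balanced_orientation_undo_splitting[OF split_off] F(1) by blast
    qed
  qed
qed

subsection \<open>Circulations and even subgraphs\<close>

definition orientation :: "('v, 'e) multipole \<Rightarrow> ('e \<Rightarrow> 'v) \<Rightarrow> ('e \<Rightarrow> 'v) \<Rightarrow> bool" where
  "orientation G tail head \<longleftrightarrow> (\<forall>e\<in>edges G. ends G e = {#tail e, head e#})"

definition net_flow :: "'e set \<Rightarrow> ('e \<Rightarrow> 'v) \<Rightarrow> ('e \<Rightarrow> 'v) \<Rightarrow> ('e \<Rightarrow> int) \<Rightarrow> 'v \<Rightarrow> int" where
  "net_flow F tail head \<phi> x = (\<Sum>e\<in>F. \<phi> e * (of_bool (head e = x) - of_bool (tail e = x)))"

definition circulation ::
    "('v, 'e) multipole \<Rightarrow> ('e \<Rightarrow> 'v) \<Rightarrow> ('e \<Rightarrow> 'v) \<Rightarrow> ('e \<Rightarrow> int) \<Rightarrow> bool" where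
  "circulation G tail head \<phi> \<longleftrightarrow> (\<forall>x\<in>verts G. net_flow (edges G) tail head \<phi> x = 0)"

definition even_subgraph :: "('v, 'e) multipole \<Rightarrow> 'e set \<Rightarrow> bool" where
  "even_subgraph G F \<longleftrightarrow> F \<subseteq> edges G \<and> (\<forall>x\<in>verts G. even (degree_in G F x))"

lemma graph_orientation:
  assumes "graph G"
  obtains tail head where "orientation G tail head"
proof -
  have "\<forall>e\<in>edges G. \<exists>x y. ends G e = {#x, y#}"
    using assms size_2_mset_ex by (auto simp: graph_def)
  with that show ?thesis unfolding orientation_def by metis
qed

lemma net_flow_eq_diff:
  assumes "finite F"
  shows "net_flow F tail head \<phi> x
       = (\<Sum>e\<in>{e \<in> F. head e = x}. \<phi> e) - (\<Sum>e\<in>{e \<in> F. tail e = x}. \<phi> e)"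
proof -
  have "net_flow F tail head \<phi> x
      = (\<Sum>e\<in>F. (if head e = x then \<phi> e else 0) - (if tail e = x then \<phi> e else 0))"
    unfolding net_flow_def by (rule sum.cong) auto
  then show ?thesis using assms by (simp add: sum_subtractf sum.inter_filter)
qed

lemma nowhere_zero_flow_iff_circulation:
  assumes "finite (edges G)"
  shows "nowhere_zero_flow k G \<longleftrightarrow>
    (\<exists>tail head \<phi>. orientation G tail head \<and> circulation G tail head \<phi> \<and>
       (\<forall>e\<in>edges G. \<phi> e \<noteq> 0 \<and> \<bar>\<phi> e\<bar> < int k))"
  unfolding nowhere_zero_flow_def orientation_def circulation_def net_flow_eq_diff[OF assms]
  by auto

lemma circulation_add:
  assumes "circulation G tail head \<phi>" "circulation G tail head \<psi>"
  shows "circulation G tail head (\<lambda>e. \<phi> e + \<psi> e)"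
  using assms by (simp add: circulation_def net_flow_def distrib_right sum.distrib)

lemma circulation_mult_iff:
  assumes "k \<noteq> 0"
  shows "circulation G tail head (\<lambda>e. k * \<phi> e) \<longleftrightarrow> circulation G tail head \<phi>"
  using assms by (simp add: circulation_def net_flow_def mult.assoc flip: sum_distrib_left)

lemma even_subgraph_odd_edges:
  assumes "finite (edges G)" "orientation G tail head" "circulation G tail head \<phi>"
  shows "even_subgraph G {e \<in> edges G. odd (\<phi> e)}"
proof -
  have "even (degree_in G {e \<in> edges G. odd (\<phi> e)} x)" if "x \<in> verts G" for x
  proof -
    have "{e \<in> edges G. odd (\<phi> e * (of_bool (head e = x) - of_bool (tail e = x)))} =
        {e \<in> {e \<in> edges G. odd (\<phi> e)}. odd (count (ends G e) x)}"
      using assms(2) by (auto simp: orientation_def split: if_splits)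
    moreover have "even (net_flow (edges G) tail head \<phi> x)"
      using assms(3) that by (simp add: circulation_def)
    ultimately show ?thesis
      using assms(1) by (simp add: net_flow_def degree_in_def even_sum_iff)
  qed
  then show ?thesis by (simp add: even_subgraph_def)
qed

lemma even_subgraph_balanced_orientation:
  assumes "graph G" "even_subgraph G A"
  obtains tail head where "balanced_orientation A (ends G) tail head"
proof -
  have "A \<subseteq> edges G" "finite A"
    using assms by (auto simp: graph_def even_subgraph_def intro: finite_subset)
  moreover have "even (degree_in G A x)" for x
  proof (cases "x \<in> verts G")
    case True
    then show ?thesis using assms(2) by (simp add: even_subgraph_def)
  next
    case False
    then have "degree_in G A x = 0"
      using assms(1) \<open>A \<subseteq> edges G\<close> by (intro degree_in_eq_0) (auto simp: graph_def)
    then show ?thesis by simp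
  qed
  ultimately have "\<exists>tail head. balanced_orientation A (ends G) tail head"
    using assms(1) unfolding degree_in_def
    by (intro even_degrees_imp_balanced_orientation) (auto simp: graph_def)
  with that show ?thesis by blast
qed

lemma even_subgraph_unit_circulation:
  assumes "graph G" and orient: "orientation G tail head" and "even_subgraph G A"
  obtains \<sigma> where "circulation G tail head \<sigma>"
    and "\<And>e. e \<in> A \<Longrightarrow> \<sigma> e \<in> {1, -1}" "\<And>e. e \<notin> A \<Longrightarrow> \<sigma> e = 0"
proof -
  have "finite (edges G)" "A \<subseteq> edges G"
    using assms(1,3) by (simp_all add: graph_def even_subgraph_def)
  obtain t h where "balanced_orientation A (ends G) t h"
    by (rule even_subgraph_balanced_orientation[OF assms(1,3)])
  then have ends: "\<And>e. e \<in> A \<Longrightarrow> ends G e = {#t e, h e#}"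
    and balanced: "(\<Sum>e\<in>A. {#t e#}) = (\<Sum>e\<in>A. {#h e#})"
    by (auto simp: balanced_orientation_def)
  define \<sigma> :: "_ \<Rightarrow> int" where "\<sigma> e = (if e \<in> A then if h e = head e then 1 else -1 else 0)" for e
  have "net_flow (edges G) tail head \<sigma> x = 0" for x
  proof -
    have "\<sigma> e * (of_bool (head e = x) - of_bool (tail e = x)) =
        of_bool (h e = x) - of_bool (t e = x)"
      if "e \<in> A" for e
    proof -
      have "{#t e, h e#} = {#tail e, head e#}"
        using ends[OF that] orient \<open>A \<subseteq> edges G\<close> that by (auto simp: orientation_def)
      then show ?thesis using that by (auto simp: \<sigma>_def doubleton_mset_eq_iff)
    qed
    then have "net_flow (edges G) tail head \<sigma> x = (\<Sum>e\<in>A. of_bool (h e = x) - of_bool (t e = x))"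
      unfolding net_flow_def using \<open>finite (edges G)\<close> \<open>A \<subseteq> edges G\<close>
      by (intro sum.mono_neutral_cong_right) (auto simp: \<sigma>_def)
    moreover have "(\<Sum>e\<in>A. of_bool (f e = x)) = int (count (\<Sum>e\<in>A. {#f e#}) x)" for f :: "_ \<Rightarrow> 'a"
      by (simp add: count_sum) (rule sum.cong; simp)
    ultimately show ?thesis by (simp add: sum_subtractf balanced)
  qed
  then show ?thesis
    by (intro that[of \<sigma>]) (auto simp: circulation_def \<sigma>_def)
qed

text \<open>
  A circulation \<open>\<phi>\<close> with values in \<open>{-3, \<dots>, 3}\<close> is \<open>2 * \<psi> - \<sigma>\<close> with \<open>\<sigma>\<close> a unit circulation on the
  edges where \<open>\<phi>\<close> is odd; where \<open>\<phi>\<close> is even, it is \<open>2\<close> or \<open>-2\<close> and \<open>\<psi>\<close> is odd.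
\<close>

lemma nowhere_zero_4_flow_imp_even_cover:
  assumes "graph G" "nowhere_zero_flow 4 G"
  obtains A B where "even_subgraph G A" "even_subgraph G B" "A \<union> B = edges G"
proof -
  have finite: "finite (edges G)" using assms(1) by (simp add: graph_def)
  obtain tail head \<phi> where orient: "orientation G tail head"
    and circulation_\<phi>: "circulation G tail head \<phi>"
    and nowhere_zero: "\<And>e. e \<in> edges G \<Longrightarrow> \<phi> e \<noteq> 0 \<and> \<bar>\<phi> e\<bar> < int 4"
    using assms(2) unfolding nowhere_zero_flow_iff_circulation[OF finite] by blast
  define A where "A = {e \<in> edges G. odd (\<phi> e)}"
  have even_A: "even_subgraph G A"
    unfolding A_def by (rule even_subgraph_odd_edges[OF finite orient circulation_\<phi>])
  obtain \<sigma> where circulation_\<sigma>: "circulation G tail head \<sigma>"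
    and unit: "\<And>e. e \<in> A \<Longrightarrow> \<sigma> e \<in> {1, -1}" and outside: "\<And>e. e \<notin> A \<Longrightarrow> \<sigma> e = 0"
    using even_subgraph_unit_circulation[OF assms(1) orient even_A] by blast
  define \<psi> where "\<psi> e = (\<phi> e + \<sigma> e) div 2" for e
  have double: "2 * \<psi> e = \<phi> e + \<sigma> e" if "e \<in> edges G" for e
  proof -
    have "even (\<phi> e + \<sigma> e)"
      using unit[of e] outside[of e] that by (cases "e \<in> A") (auto simp: A_def)
    then show ?thesis by (simp add: \<psi>_def)
  qed
  have "circulation G tail head (\<lambda>e. 2 * \<psi> e)"
    using circulation_add[OF circulation_\<phi> circulation_\<sigma>]
    by (simp add: circulation_def net_flow_def double)
  then have "circulation G tail head \<psi>" by (simp add: circulation_mult_iff)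
  then have "even_subgraph G {e \<in> edges G. odd (\<psi> e)}"
    by (rule even_subgraph_odd_edges[OF finite orient])
  moreover have "odd (\<psi> e)" if "e \<in> edges G" "e \<notin> A" for e
  proof -
    have "2 * \<psi> e = \<phi> e" using double outside that by simp
    with nowhere_zero[OF that(1)] have "\<psi> e = 1 \<or> \<psi> e = -1" by auto
    then show ?thesis by auto
  qed
  then have "A \<union> {e \<in> edges G. odd (\<psi> e)} = edges G" by (auto simp: A_def)
  ultimately show ?thesis using that even_A by blast
qed

lemma even_cover_imp_nowhere_zero_4_flow:
  assumes "graph G" "even_subgraph G A" "even_subgraph G B" "A \<union> B = edges G"
  shows "nowhere_zero_flow 4 G"
proof -
  have finite: "finite (edges G)" using assms(1) by (simp add: graph_def)
  obtain tail head where orient: "orientation G tail head"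
    by (rule graph_orientation[OF assms(1)])
  obtain \<alpha> where circulation_\<alpha>: "circulation G tail head \<alpha>"
    and \<alpha>: "\<And>e. e \<in> A \<Longrightarrow> \<alpha> e \<in> {1, -1}" "\<And>e. e \<notin> A \<Longrightarrow> \<alpha> e = 0"
    using even_subgraph_unit_circulation[OF assms(1) orient assms(2)] by blast
  obtain \<beta> where circulation_\<beta>: "circulation G tail head \<beta>"
    and \<beta>: "\<And>e. e \<in> B \<Longrightarrow> \<beta> e \<in> {1, -1}" "\<And>e. e \<notin> B \<Longrightarrow> \<beta> e = 0"
    using even_subgraph_unit_circulation[OF assms(1) orient assms(3)] by blast
  have "circulation G tail head (\<lambda>e. \<alpha> e + 2 * \<beta> e)"
    using circulation_\<alpha> circulation_\<beta> by (simp add: circulation_add circulation_mult_iff)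
  moreover have "\<alpha> e + 2 * \<beta> e \<noteq> 0 \<and> \<bar>\<alpha> e + 2 * \<beta> e\<bar> < int 4" if "e \<in> edges G" for e
  proof -
    have "e \<in> A \<or> e \<in> B" using that assms(4) by blast
    then show ?thesis using \<alpha>[of e] \<beta>[of e] by (cases "e \<in> A"; cases "e \<in> B") auto
  qed
  ultimately show ?thesis
    unfolding nowhere_zero_flow_iff_circulation[OF finite] using orient by blast
qed

lemma nowhere_zero_4_flow_iff_even_cover:
  assumes "graph G"
  shows "nowhere_zero_flow 4 G \<longleftrightarrow>
    (\<exists>A B. even_subgraph G A \<and> even_subgraph G B \<and> A \<union> B = edges G)"
  using nowhere_zero_4_flow_imp_even_cover[OF assms]
    even_cover_imp_nowhere_zero_4_flow[OF assms] by metis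

subsection \<open>Colourings of cubic multipoles\<close>

definition colour_class :: "('v, 'e) multipole \<Rightarrow> ('e \<Rightarrow> nat) \<Rightarrow> nat \<Rightarrow> 'e set" where
  "colour_class M c i = {e \<in> edges M. c e = i}"

lemma colour_class_subset: "colour_class M c i \<subseteq> edges M"
  by (auto simp: colour_class_def)

definition cubic_multipole :: "('v, 'e) multipole \<Rightarrow> bool" where
  "cubic_multipole M \<longleftrightarrow> finite (edges M) \<and> (\<forall>e\<in>edges M. set_mset (ends M e) \<subseteq> verts M) \<and>
     (\<forall>x\<in>verts M. degree M x = 3)"

lemma degree_in_le_1_iff:
  assumes "finite F"
  shows "degree_in M F x \<le> 1 \<longleftrightarrow> (\<forall>e\<in>F. count (ends M e) x \<le> 1) \<and>
    (\<forall>e\<in>F. \<forall>f\<in>F. e \<noteq> f \<longrightarrow> \<not> (x \<in># ends M e \<and> x \<in># ends M f))" (is "?low \<longleftrightarrow> ?matching")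
proof
  assume ?low
  have "count (ends M e) x \<le> 1" if "e \<in> F" for e
    using \<open>?low\<close> degree_in_remove[OF assms that, of M x] by simp
  moreover have "\<not> (x \<in># ends M e \<and> x \<in># ends M f)" if "e \<in> F" "f \<in> F" "e \<noteq> f" for e f
  proof -
    have "degree_in M F x \<ge> count (ends M e) x + count (ends M f) x"
      using degree_in_remove[OF assms that(1), of M x]
        degree_in_remove[of "F - {e}" f M x] assms that by simp
    with \<open>?low\<close> show ?thesis by (auto simp flip: count_greater_zero_iff)
  qed
  ultimately show ?matching by blast
next
  assume ?matching
  show ?low
  proof (cases "\<exists>e\<in>F. x \<in># ends M e")
    case True
    then obtain e where "e \<in> F" "x \<in># ends M e" by blast
    then have "degree_in M (F - {e}) x = 0"
      using \<open>?matching\<close> by (intro degree_in_eq_0) blast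
    then show ?thesis
      using \<open>?matching\<close> \<open>e \<in> F\<close> by (simp add: degree_in_remove[OF assms \<open>e \<in> F\<close>])
  next
    case False
    then have "degree_in M F x = 0" by (intro degree_in_eq_0) blast
    then show ?thesis by simp
  qed
qed

lemma proper_edge_colouring_iff_degree_in:
  assumes "finite (edges M)" "\<And>e. e \<in> edges M \<Longrightarrow> set_mset (ends M e) \<subseteq> verts M"
    and "\<And>e. e \<in> edges M \<Longrightarrow> c e < k"
  shows "proper_edge_colouring k M c \<longleftrightarrow>
    (\<forall>x\<in>verts M. \<forall>i<k. degree_in M (colour_class M c i) x \<le> 1)"
proof -
  have finite: "finite (colour_class M c i)" for i
    using assms(1) by (simp add: colour_class_def)
  have "degree_in M (colour_class M c i) x = 0" if "\<not> (x \<in> verts M \<and> i < k)" for x i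
    using that assms(2,3) by (intro degree_in_eq_0) (auto simp: colour_class_def)
  then have "(\<forall>x\<in>verts M. \<forall>i<k. degree_in M (colour_class M c i) x \<le> 1) \<longleftrightarrow>
      (\<forall>x i. degree_in M (colour_class M c i) x \<le> 1)"
    by (metis zero_le_one)
  also have "\<dots> \<longleftrightarrow> proper_edge_colouring k M c"
    unfolding proper_edge_colouring_def degree_in_le_1_iff[OF finite]
    using assms(3) by (simp only: colour_class_def) blast
  finally show ?thesis ..
qed

lemma sum_degree_in_colour_class:
  assumes "finite (edges M)" "\<And>e. e \<in> edges M \<Longrightarrow> c e < k"
  shows "(\<Sum>i<k. degree_in M (colour_class M c i) x) = degree M x"
  unfolding degree_in_def degree_def colour_class_def
  by (rule sum.group) (use assms in auto)

lemma proper_3_edge_colouring_iff_even_subgraph: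
  assumes cubic: "cubic_multipole M" and colours: "\<And>e. e \<in> edges M \<Longrightarrow> c e < 3"
  shows "proper_edge_colouring 3 M c \<longleftrightarrow>
    even_subgraph M (colour_class M c 0 \<union> colour_class M c 1) \<and>
    even_subgraph M (colour_class M c 0 \<union> colour_class M c 2)" (is "_ \<longleftrightarrow> ?even_unions")
proof -
  let ?d = "\<lambda>i x. degree_in M (colour_class M c i) x"
  have finite: "finite (edges M)" and ends: "\<And>e. e \<in> edges M \<Longrightarrow> set_mset (ends M e) \<subseteq> verts M"
    using cubic by (auto simp: cubic_multipole_def)
  have lessThan_3: "{..<3} = {0, 1, 2::nat}" by auto
  have union: "degree_in M (colour_class M c i \<union> colour_class M c j) x = ?d i x + ?d j x"
    if "i \<noteq> j" for i j x
    using that finite by (intro degree_in_Un_disjoint) (auto simp: colour_class_def)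
  have sum: "?d 0 x + ?d 1 x + ?d 2 x = 3" if "x \<in> verts M" for x
    using sum_degree_in_colour_class[of M c 3 x, OF finite colours] cubic that
    by (simp add: cubic_multipole_def lessThan_3)
  have "proper_edge_colouring 3 M c \<longleftrightarrow> (\<forall>x\<in>verts M. \<forall>i\<in>{..<3}. ?d i x \<le> 1)"
    by (simp add: proper_edge_colouring_iff_degree_in[of M c 3, OF finite ends colours] Ball_def)
  also have "\<dots> \<longleftrightarrow> (\<forall>x\<in>verts M. ?d 0 x \<le> 1 \<and> ?d 1 x \<le> 1 \<and> ?d 2 x \<le> 1)"
    unfolding lessThan_3 by simp
  also have "\<dots> \<longleftrightarrow> (\<forall>x\<in>verts M. even (?d 0 x + ?d 1 x) \<and> even (?d 0 x + ?d 2 x))"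
  proof -
    have "p \<le> 1 \<and> q \<le> 1 \<and> r \<le> 1 \<longleftrightarrow> even (p + q) \<and> even (p + r)"
      if "p + q + r = 3" for p q r :: nat
      using that by presburger
    then show ?thesis using sum by meson
  qed
  also have "\<dots> \<longleftrightarrow> ?even_unions"
    using colour_class_subset[of M c] by (auto simp: even_subgraph_def union)
  finally show ?thesis .
qed

lemma edge_colourable_3_iff_even_cover:
  assumes "cubic_multipole M"
  shows "edge_colourable 3 M \<longleftrightarrow>
    (\<exists>A B. even_subgraph M A \<and> even_subgraph M B \<and> A \<union> B = edges M)"
proof
  assume "edge_colourable 3 M"
  then obtain c where proper: "proper_edge_colouring 3 M c" by (auto simp: edge_colourable_def)
  then have colours: "c e < 3" if "e \<in> edges M" for e
    using that by (simp add: proper_edge_colouring_def)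
  then have "c e = 0 \<or> c e = 1 \<or> c e = 2" if "e \<in> edges M" for e
    using that by fastforce
  then have "(colour_class M c 0 \<union> colour_class M c 1) \<union>
      (colour_class M c 0 \<union> colour_class M c 2) = edges M"
    by (auto simp: colour_class_def)
  with proper proper_3_edge_colouring_iff_even_subgraph[of M c, OF assms colours]
  show "\<exists>A B. even_subgraph M A \<and> even_subgraph M B \<and> A \<union> B = edges M" by blast
next
  assume "\<exists>A B. even_subgraph M A \<and> even_subgraph M B \<and> A \<union> B = edges M"
  then obtain A B where even: "even_subgraph M A" "even_subgraph M B" and cover: "A \<union> B = edges M"
    by blast
  define c where "c e = (if e \<notin> B then 1 else if e \<notin> A then 2 else 0::nat)" for e
  have "A = colour_class M c 0 \<union> colour_class M c 1" "B = colour_class M c 0 \<union> colour_class M c 2"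
    using cover by (auto simp: colour_class_def c_def split: if_splits)
  moreover have "c e < 3" for e by (simp add: c_def)
  ultimately have "proper_edge_colouring 3 M c"
    using proper_3_edge_colouring_iff_even_subgraph[OF assms, of c] even by metis
  then show "edge_colourable 3 M" by (auto simp: edge_colourable_def)
qed

subsection \<open>Removing and identifying two vertices\<close>

lemma degree_in_remove_verts:
  assumes "x \<notin> X"
  shows "degree_in (remove_verts G X) F x = degree_in G F x"
  using assms by (simp add: degree_in_def remove_verts_def)

lemma cubic_multipole_remove_verts:
  assumes "cubic_graph G"
  shows "cubic_multipole (remove_verts G X)"
  using assms degree_in_remove_verts[of _ X G "edges G"]
  by (auto simp: cubic_graph_def graph_def cubic_multipole_def remove_verts_def degree_eq_degree_in)

lemma graph_identify:
  assumes "graph G"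
  shows "graph (identify G u v)"
  using assms by (auto simp: graph_def identify_def Let_def)

lemma degree_in_identify:
  assumes "x \<noteq> u" "x \<noteq> v"
  shows "degree_in (identify G u v) F x = degree_in G F x"
proof -
  have "count (image_mset (\<lambda>x. if x = v then u else x) N) x = count N x" for N
    using assms by (induction N) auto
  then show ?thesis by (simp add: degree_in_def identify_def Let_def)
qed

lemma even_degree_in_last_vertex:
  assumes "graph G" "F \<subseteq> edges G" "u \<in> verts G"
    and "\<And>x. x \<in> verts G - {u} \<Longrightarrow> even (degree_in G F x)"
  shows "even (degree_in G F u)"
proof -
  have "finite (verts G)" using assms(1) by (simp add: graph_def)
  then have "degree_in G F u + (\<Sum>x\<in>verts G - {u}. degree_in G F x) = 2 * card F"
    using assms(3) by (simp flip: graph_sum_degree_in[OF assms(1,2)] sum.remove)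
  moreover have "even (\<Sum>x\<in>verts G - {u}. degree_in G F x)"
    using assms(4) by (rule dvd_sum)
  ultimately show ?thesis by (metis dvd_triv_left even_add)
qed

lemma even_subgraph_identify_iff:
  assumes "graph G" "u \<in> verts G" "v \<in> verts G"
  shows "even_subgraph (identify G u v) F \<longleftrightarrow> even_subgraph (remove_verts G {u, v}) F"
proof -
  let ?I = "identify G u v"
  have identify: "verts ?I = insert u (verts G - {u, v})" "edges ?I = edges G"
    using assms(2,3) by (auto simp: identify_def Let_def)
  have remove: "verts (remove_verts G {u, v}) = verts G - {u, v}"
    "edges (remove_verts G {u, v}) = edges G"
    by (simp_all add: remove_verts_def)
  have "even (degree_in ?I F u)"
    if "F \<subseteq> edges G" "\<forall>x\<in>verts G - {u, v}. even (degree_in ?I F x)"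
    by (rule even_degree_in_last_vertex[OF graph_identify[OF assms(1)]])
      (use that in \<open>auto simp: identify\<close>)
  moreover have "degree_in ?I F x = degree_in (remove_verts G {u, v}) F x"
    if "x \<in> verts G - {u, v}" for x
    using that by (simp add: degree_in_identify degree_in_remove_verts)
  ultimately show ?thesis
    by (auto simp: even_subgraph_def identify remove)
qed

lemma nowhere_zero_4_flow_identify_iff:
  assumes "cubic_graph G" "u \<in> verts G" "v \<in> verts G"
  shows "nowhere_zero_flow 4 (identify G u v) \<longleftrightarrow> edge_colourable 3 (remove_verts G {u, v})"
proof -
  have "graph G" using assms(1) by (simp add: cubic_graph_def)
  moreover have "edges (identify G u v) = edges (remove_verts G {u, v})"
    by (simp add: identify_def remove_verts_def Let_def)
  ultimately show ?thesis
    by (simp add: nowhere_zero_4_flow_iff_even_cover graph_identify assms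
        edge_colourable_3_iff_even_cover cubic_multipole_remove_verts even_subgraph_identify_iff)
qed

lemma bicritical_iff_four_vertex_critical:
  assumes "cubic_graph G"
  shows "bicritical G \<longleftrightarrow> four_vertex_critical G"
  by (simp add: bicritical_def four_vertex_critical_def
      nowhere_zero_4_flow_identify_iff[OF assms])

subsection \<open>Greedy colouring\<close>

definition submultipole :: "('v, 'e) multipole \<Rightarrow> ('v, 'e) multipole \<Rightarrow> bool" where
  "submultipole K M \<longleftrightarrow> verts K \<subseteq> verts M \<and> edges K \<subseteq> edges M \<and> (\<forall>e\<in>edges K. ends K e = ends M e)"

definition low_degree_edge :: "('v, 'e) multipole \<Rightarrow> nat \<Rightarrow> 'e set \<Rightarrow> 'e \<Rightarrow> bool" where
  "low_degree_edge M k F e \<longleftrightarrow> (\<forall>x. count (ends M e) x \<le> 1) \<and>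
     (\<Sum>x\<in>set_mset (ends M e). degree_in M (F - {e}) x) < k"

lemma edge_colourable_mono:
  assumes "edge_colourable k M" "k \<le> l" "submultipole N M"
  shows "edge_colourable l N"
proof -
  obtain c where "proper_edge_colouring k M c"
    using assms(1) by (auto simp: edge_colourable_def)
  then have "proper_edge_colouring l N c"
    using assms(2,3) unfolding proper_edge_colouring_def submultipole_def
    by (metis (no_types, lifting) order_less_le_trans subsetD)
  then show ?thesis by (auto simp: edge_colourable_def)
qed

lemma edge_colourable_add_low_degree_edge:
  assumes "finite F" "edge_colourable k (M\<lparr>edges := F - {e}\<rparr>)" "low_degree_edge M k F e"
  shows "edge_colourable k (M\<lparr>edges := F\<rparr>)"
proof -
  obtain c where proper: "proper_edge_colouring k (M\<lparr>edges := F - {e}\<rparr>) c"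
    using assms(2) by (auto simp: edge_colourable_def)
  let ?N = "incident_edges M (F - {e}) (set_mset (ends M e))"
  have "card (c ` ?N) \<le> card ?N"
    by (rule card_image_le) (use assms(1) in \<open>simp add: incident_edges_def\<close>)
  also have "\<dots> \<le> (\<Sum>x\<in>set_mset (ends M e). degree_in M (F - {e}) x)"
    using assms(1) by (intro card_incident_edges_le) auto
  also have "\<dots> < card {..<k}" using assms(3) by (simp add: low_degree_edge_def)
  finally have "\<not> {..<k} \<subseteq> c ` ?N"
    using assms(1) by (auto simp: incident_edges_def not_le dest!: card_mono[rotated])
  then obtain i where "i < k" and unused: "i \<notin> c ` ?N" by auto
  have "c f \<noteq> i" if "f \<in> F - {e}" "set_mset (ends M e) \<inter> set_mset (ends M f) \<noteq> {}" for f
    using unused that by (auto simp: incident_edges_def)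
  then have "proper_edge_colouring k (M\<lparr>edges := F\<rparr>) (c(e := i))"
    using proper \<open>i < k\<close> assms(3) unfolding proper_edge_colouring_def low_degree_edge_def
    by (auto simp: Int_commute)
  then show ?thesis by (auto simp: edge_colourable_def)
qed

lemma edge_colourable_greedy:
  assumes "finite F" "F\<^sub>0 \<subseteq> F" "edge_colourable k (M\<lparr>edges := F\<^sub>0\<rparr>)"
    and "\<And>F'. F\<^sub>0 \<subset> F' \<Longrightarrow> F' \<subseteq> F \<Longrightarrow> \<exists>e\<in>F' - F\<^sub>0. low_degree_edge M k F' e"
  shows "edge_colourable k (M\<lparr>edges := F\<rparr>)"
  using assms
proof (induction F rule: finite_psubset_induct)
  case (psubset F)
  show ?case
  proof (cases "F = F\<^sub>0")
    case True
    then show ?thesis using psubset.prems(2) by simp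
  next
    case False
    then obtain e where e_new: "e \<in> F - F\<^sub>0" and e_low: "low_degree_edge M k F e"
      using psubset.prems(1,3) by blast
    have "edge_colourable k (M\<lparr>edges := F - {e}\<rparr>)"
    proof (rule psubset.IH)
      show "\<exists>e\<in>F' - F\<^sub>0. low_degree_edge M k F' e" if "F\<^sub>0 \<subset> F'" "F' \<subseteq> F - {e}" for F'
        using psubset.prems(3) that by blast
    qed (use e_new psubset.prems(1,2) in auto)
    from edge_colourable_add_low_degree_edge[OF psubset.hyps this e_low] show ?thesis .
  qed
qed

lemma connected_edge_boundary:
  assumes "graph G" "connected G" "F \<subset> edges G" "F \<noteq> {}"
  shows "\<exists>x. \<exists>e\<in>F. \<exists>f\<in>edges G - F. x \<in># ends G e \<and> x \<in># ends G f"
proof (rule ccontr)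
  assume no_boundary: "\<not> ?thesis"
  define T where "T = {x. \<exists>e\<in>F. x \<in># ends G e}"
  have avoids: "x \<notin># ends G f" if "f \<in> edges G - F" "x \<in> T" for f x
    using no_boundary that by (auto simp: T_def)
  have closed: "y \<in> T" if "x \<in> T" and adjacent: "adjacent G x y" for x y
  proof -
    obtain f where "f \<in> edges G" and ends_f: "ends G f = {#x, y#}"
      using adjacent by (auto simp: adjacent_def)
    then have "f \<in> F" using avoids[of f x] \<open>x \<in> T\<close> by auto
    with ends_f show ?thesis by (force simp: T_def)
  qed
  obtain e f where "e \<in> F" "e \<in> edges G" "f \<in> edges G - F" using assms(3,4) by blast
  then obtain x y where "x \<in> verts G" "x \<in># ends G e" "y \<in> verts G" "y \<in># ends G f"
    using graph_edge_ex_end[OF assms(1)] by (metis DiffD1)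
  then have "x \<in> T" using \<open>e \<in> F\<close> by (auto simp: T_def)
  have "(adjacent G)\<^sup>*\<^sup>* x y"
    using assms(2) \<open>x \<in> verts G\<close> \<open>y \<in> verts G\<close> by (simp add: connected_def)
  then have "y \<in> T" by (induction rule: rtranclp_induct) (use \<open>x \<in> T\<close> closed in auto)
  with avoids[OF \<open>f \<in> edges G - F\<close>] \<open>y \<in># ends G f\<close> show False by blast
qed

lemma low_degree_edge_bounded_degree:
  assumes "finite F" "e \<in> F" "ends G e = {#x, y#}" "x \<noteq> y"
    and "degree_in G F x < d" "degree_in G F y \<le> d"
  shows "low_degree_edge G (2 * d - 2) F e"
  using assms degree_in_remove[OF assms(1,2), of G x] degree_in_remove[OF assms(1,2), of G y]
  by (auto simp: low_degree_edge_def)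

lemma connected_ex_low_degree_edge:
  assumes "graph G" "connected G" "\<And>x. x \<in> verts G \<Longrightarrow> degree G x \<le> d" "F \<subset> edges G" "F \<noteq> {}"
    and loopless: "\<And>e x. e \<in> F \<Longrightarrow> count (ends G e) x \<le> 1"
  shows "\<exists>e\<in>F. low_degree_edge G (2 * d - 2) F e"
proof -
  have finite: "finite (edges G)" "finite F"
    using assms(1,4) by (auto simp: graph_def intro: finite_subset)
  have bound: "degree_in G (edges G) x \<le> d" if "x \<in> verts G" for x
    using assms(3)[OF that] by (simp add: degree_eq_degree_in)
  obtain x e f where e: "e \<in> F" "x \<in># ends G e" and f: "f \<in> edges G" "f \<notin> F" "x \<in># ends G f"
    using connected_edge_boundary[OF assms(1,2,4,5)] by blast
  have "e \<in> edges G" using e(1) assms(4) by blast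
  from assms(1) this e(2) obtain y where ends_e: "ends G e = {#x, y#}" "x \<in> verts G" "y \<in> verts G"
    by (rule graph_edge_other_end)
  then have "x \<noteq> y" using loopless[OF e(1), of x] by auto
  have "degree_in G F x \<le> degree_in G (edges G - {f}) x"
    using assms(4) f(2) finite by (intro degree_in_mono) auto
  also have "\<dots> < degree_in G (edges G) x"
    using degree_in_remove[OF finite(1) f(1), of G x] f(3) by simp
  finally have "degree_in G F x < d" using bound[OF ends_e(2)] by simp
  moreover have "degree_in G F y \<le> d"
    using degree_in_mono[OF finite(1), of F G y] assms(4) bound[OF ends_e(3)] by auto
  ultimately show ?thesis
    using low_degree_edge_bounded_degree[OF finite(2) e(1) ends_e(1) \<open>x \<noteq> y\<close>] e(1) by blast
qed

lemma edge_colourable_proper_edge_subset: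
  assumes "graph G" "connected G" "\<And>x. x \<in> verts G \<Longrightarrow> degree G x \<le> d" "F \<subset> edges G"
    and "\<And>e x. e \<in> F \<Longrightarrow> count (ends G e) x \<le> 1"
  shows "edge_colourable (2 * d - 2) (G\<lparr>edges := F\<rparr>)"
proof (rule edge_colourable_greedy)
  show "finite F" using assms(1,4) by (auto simp: graph_def intro: finite_subset)
  show "edge_colourable (2 * d - 2) (G\<lparr>edges := {}\<rparr>)"
    by (simp add: edge_colourable_def proper_edge_colouring_def)
  show "\<exists>e\<in>F' - {}. low_degree_edge G (2 * d - 2) F' e" if "{} \<subset> F'" "F' \<subseteq> F" for F'
    using connected_ex_low_degree_edge[OF assms(1-3), of F'] assms(4,5) that by blast
qed simp

lemma low_degree_edge_remove_verts:
  assumes "graph G" "\<And>x. x \<in> verts G \<Longrightarrow> degree G x \<le> k" "0 < k"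
    and "F \<subseteq> edges G" "e \<in> incident_edges G F X"
  shows "low_degree_edge (remove_verts G X) k F e"
proof -
  let ?M = "remove_verts G X"
  have finite: "finite (edges G)" "finite F"
    using assms(1,4) by (auto simp: graph_def intro: finite_subset)
  obtain y where "e \<in> F" "y \<in> X" "y \<in># ends G e"
    using assms(5) by (auto simp: incident_edges_def)
  moreover from this(1) have "e \<in> edges G" using assms(4) by blast
  ultimately obtain z where ends_e: "ends G e = {#y, z#}" and "z \<in> verts G"
    using graph_edge_other_end[OF assms(1)] by metis
  then have ends_remove: "ends ?M e = (if z \<in> X then {#} else {#z#})"
    using \<open>y \<in> X\<close> by (simp add: remove_verts_def)
  have "degree_in ?M (F - {e}) z < k" if "z \<notin> X"
  proof -
    have "degree_in G F z \<le> degree_in G (edges G) z"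
      using finite(1) assms(4) by (rule degree_in_mono)
    also have "\<dots> \<le> k"
      using assms(2)[OF \<open>z \<in> verts G\<close>] by (simp add: degree_eq_degree_in)
    finally show ?thesis
      using degree_in_remove[OF finite(2) \<open>e \<in> F\<close>, of G z] ends_e that
      by (simp add: degree_in_remove_verts split: if_splits)
  qed
  with assms(3) show ?thesis by (simp add: low_degree_edge_def ends_remove)
qed

lemma edge_colourable_remove_verts:
  assumes "graph G" "\<And>x. x \<in> verts G \<Longrightarrow> degree G x \<le> k" "0 < k"
    and "edge_colourable k (remove_edges G (incident_edges G (edges G) X))"
      (is "edge_colourable k (remove_edges G ?S)")
  shows "edge_colourable k (remove_verts G X)"
proof -
  let ?M = "remove_verts G X"
  have "edge_colourable k (?M\<lparr>edges := edges G\<rparr>)"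
  proof (rule edge_colourable_greedy)
    have "ends ?M e = ends G e" if "e \<in> edges G - ?S" for e
      using that by (auto simp: remove_verts_def incident_edges_def filter_mset_eq_conv)
    then have "submultipole (?M\<lparr>edges := edges G - ?S\<rparr>) (remove_edges G ?S)"
      by (auto simp: submultipole_def remove_verts_def remove_edges_def)
    with assms(4) show "edge_colourable k (?M\<lparr>edges := edges G - ?S\<rparr>)"
      by (rule edge_colourable_mono[OF _ order_refl])
    show "\<exists>e\<in>F' - (edges G - ?S). low_degree_edge ?M k F' e"
      if larger: "edges G - ?S \<subset> F'" "F' \<subseteq> edges G" for F'
    proof -
      obtain e where "e \<in> F'" "e \<in> ?S" using larger by blast
      then have "e \<in> incident_edges G F' X" by (simp add: incident_edges_def)
      from low_degree_edge_remove_verts[OF assms(1-3) larger(2) this] show ?thesis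
        using \<open>e \<in> F'\<close> \<open>e \<in> ?S\<close> by blast
    qed
  qed (use assms(1) in \<open>auto simp: graph_def\<close>)
  then show ?thesis by (simp add: remove_verts_def)
qed

subsection \<open>Components\<close>

lemma components_submultipole:
  assumes "K \<in> components G"
  shows "submultipole K G"
  using assms by (auto simp: components_def component_of_def Let_def submultipole_def)

lemma components_ends_subset:
  assumes "K \<in> components G" "e \<in> edges K"
  shows "set_mset (ends G e) \<subseteq> verts K"
  using assms by (auto simp: components_def component_of_def Let_def)

lemma graph_component:
  assumes "graph G" "K \<in> components G"
  shows "graph K"
proof -
  have "submultipole K G" "\<And>e. e \<in> edges K \<Longrightarrow> set_mset (ends G e) \<subseteq> verts K"
    using assms(2) by (rule components_submultipole, rule components_ends_subset)
  then show ?thesis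
    using assms(1) by (auto simp: graph_def submultipole_def intro: finite_subset)
qed

lemma component_of_in_components:
  assumes "x \<in> verts G"
  shows "component_of G x \<in> components G" "x \<in> verts (component_of G x)"
  using assms by (auto simp: components_def component_of_def Let_def)

lemma adjacent_sym: "adjacent G x y \<Longrightarrow> adjacent G y x"
  unfolding adjacent_def by (metis add_mset_commute)

lemma reachable_sym: "(adjacent G)\<^sup>*\<^sup>* x y \<Longrightarrow> (adjacent G)\<^sup>*\<^sup>* y x"
  by (rule sympD[OF symp_rtranclp]) (auto intro: sympI adjacent_sym)

lemma components_eq_component_of:
  assumes "K \<in> components G" "x \<in> verts K"
  shows "K = component_of G x"
proof -
  obtain y where K_eq: "K = component_of G y" and "(adjacent G)\<^sup>*\<^sup>* y x"
    using assms by (auto simp: components_def component_of_def Let_def)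
  then have "(adjacent G)\<^sup>*\<^sup>* y z \<longleftrightarrow> (adjacent G)\<^sup>*\<^sup>* x z" for z
    by (meson reachable_sym rtranclp_trans)
  then show ?thesis by (simp add: K_eq component_of_def)
qed

lemma edge_in_component:
  assumes "graph G" "K \<in> components G" "e \<in> edges G" "x \<in># ends G e" "x \<in> verts K"
  shows "e \<in> edges K"
proof -
  obtain y where ends_e: "ends G e = {#x, y#}" "x \<in> verts G" "y \<in> verts G"
    by (rule graph_edge_other_end[OF assms(1,3,4)])
  then have "adjacent G x y" using assms(3) by (auto simp: adjacent_def)
  then show ?thesis
    using ends_e assms(3)
    by (simp add: components_eq_component_of[OF assms(2,5)] component_of_def Let_def)
qed

lemma edge_in_some_component:
  assumes "graph G" "e \<in> edges G" "x \<in># ends G e"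
  obtains K where "K \<in> components G" "x \<in> verts K" "e \<in> edges K"
proof -
  have "x \<in> verts G" using assms by (auto simp: graph_def)
  then show ?thesis
    using component_of_in_components[of x G] edge_in_component[OF assms(1)] assms(2,3) that by blast
qed

lemma proper_edge_colouring_components:
  assumes "graph G" "\<And>K. K \<in> components G \<Longrightarrow> proper_edge_colouring k K c"
  shows "proper_edge_colouring k G c"
proof -
  have ends: "ends K e = ends G e" if "K \<in> components G" "e \<in> edges K" for K e
    using components_submultipole that by (auto simp: submultipole_def)
  have "c e < k \<and> (\<forall>x. count (ends G e) x \<le> 1)" if e: "e \<in> edges G" for e
  proof -
    obtain x where "x \<in># ends G e" using graph_edge_ex_end[OF assms(1) e] by blast
    with assms(1) e obtain K where "K \<in> components G" "e \<in> edges K"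
      by (rule edge_in_some_component)
    with assms(2) show ?thesis by (simp add: proper_edge_colouring_def flip: ends)
  qed
  moreover have "c e \<noteq> c f"
    if e: "e \<in> edges G" "x \<in># ends G e" and f: "f \<in> edges G" "x \<in># ends G f" and "e \<noteq> f" for e f x
  proof -
    obtain K where K: "K \<in> components G" "x \<in> verts K" "e \<in> edges K"
      by (rule edge_in_some_component[OF assms(1) e])
    then have "f \<in> edges K" using edge_in_component[OF assms(1)] f by blast
    moreover have "set_mset (ends K e) \<inter> set_mset (ends K f) \<noteq> {}"
      using e(2) f(2) by (auto simp: ends K calculation)
    ultimately show ?thesis
      using assms(2)[OF K(1)] K(3) \<open>e \<noteq> f\<close> unfolding proper_edge_colouring_def by blast
  qed
  ultimately show ?thesis
    unfolding proper_edge_colouring_def by blast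
qed

lemma proper_edge_colouring_cong:
  assumes "\<And>e. e \<in> edges M \<Longrightarrow> c e = d e"
  shows "proper_edge_colouring k M c \<longleftrightarrow> proper_edge_colouring k M d"
  using assms by (simp add: proper_edge_colouring_def)

lemma edge_colourable_components:
  assumes "graph G" and colourable: "\<And>K. K \<in> components G \<Longrightarrow> edge_colourable k K"
  shows "edge_colourable k G"
proof -
  obtain \<chi> where proper: "\<And>K. K \<in> components G \<Longrightarrow> proper_edge_colouring k K (\<chi> K)"
    using colourable unfolding edge_colourable_def by metis
  define end_of where "end_of e = (SOME x. x \<in># ends G e)" for e
  define c where "c e = \<chi> (component_of G (end_of e)) e" for e
  have "proper_edge_colouring k K c" if K: "K \<in> components G" for K
  proof -
    have "K = component_of G (end_of e)" if "e \<in> edges K" for e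
    proof -
      have "e \<in> edges G" using components_submultipole[OF K] that by (auto simp: submultipole_def)
      then have "end_of e \<in># ends G e"
        unfolding end_of_def using graph_edge_ex_end[OF assms(1)] by (metis someI_ex)
      then show ?thesis
        using components_eq_component_of[OF K] components_ends_subset[OF K that] by blast
    qed
    then have "c e = \<chi> K e" if "e \<in> edges K" for e using that by (simp add: c_def)
    with proper[OF K] show ?thesis using proper_edge_colouring_cong by blast
  qed
  then show ?thesis
    using proper_edge_colouring_components[OF assms(1)] by (auto simp: edge_colourable_def)
qed

lemma isolated_vertex_notin_component:
  assumes "graph G" "\<And>e. e \<in> edges G \<Longrightarrow> x \<notin># ends G e" "K \<in> components G" "edges K \<noteq> {}"
  shows "x \<notin> verts K"
proof
  assume "x \<in> verts K"
  with assms(3) have K_eq: "K = component_of G x" by (rule components_eq_component_of)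
  have "\<not> adjacent G x y" for y
    using assms(2) by (fastforce simp: adjacent_def)
  then have "y = x" if "(adjacent G)\<^sup>*\<^sup>* x y" for y
    using that by (auto elim: converse_rtranclpE)
  then have "verts K \<subseteq> {x}" by (auto simp: K_eq component_of_def Let_def)
  obtain e where "e \<in> edges K" using assms(4) by blast
  then have "e \<in> edges G" "set_mset (ends G e) \<subseteq> verts K"
    using components_submultipole[OF assms(3)] components_ends_subset[OF assms(3)]
    by (auto simp: submultipole_def)
  moreover from this(1) obtain y where "y \<in># ends G e"
    using graph_edge_ex_end[OF assms(1)] by blast
  ultimately show False using \<open>verts K \<subseteq> {x}\<close> assms(2) by blast
qed

lemma ex_uncolourable_component:
  assumes G: "graph G" "\<And>x. x \<in> verts G \<Longrightarrow> degree G x \<le> k" "0 < k"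
    and uncolourable: "\<not> edge_colourable k (remove_verts G X)"
  defines "R \<equiv> remove_edges G (incident_edges G (edges G) X)"
  obtains K where "K \<in> components R" "\<not> edge_colourable k K" "verts K \<inter> X = {}"
proof -
  have "graph R" using G(1) by (auto simp: graph_def R_def remove_edges_def)
  have "\<not> edge_colourable k R"
    using edge_colourable_remove_verts[OF G] uncolourable by (auto simp: R_def)
  then obtain K where K: "K \<in> components R" "\<not> edge_colourable k K"
    using edge_colourable_components[OF \<open>graph R\<close>] by blast
  then have "edges K \<noteq> {}" by (auto simp: edge_colourable_def proper_edge_colouring_def)
  have "x \<notin> verts K" if "x \<in> X" for x
  proof -
    have "x \<notin># ends R e" if "e \<in> edges R" for e
      using that \<open>x \<in> X\<close> by (auto simp: R_def remove_edges_def incident_edges_def)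
    then show ?thesis
      using \<open>graph R\<close> K(1) \<open>edges K \<noteq> {}\<close> by (intro isolated_vertex_notin_component)
  qed
  with K that show ?thesis by blast
qed

subsection \<open>Completion to a cubic graph\<close>

lemma mset_partition_pairs:
  fixes D :: "'a multiset"
  assumes "finite F" "size D = 2 * card F"
  obtains N where "\<And>e. e \<in> F \<Longrightarrow> size (N e) = 2" "(\<Sum>e\<in>F. N e) = D"
proof -
  have "\<exists>N. (\<forall>e\<in>F. size (N e) = 2) \<and> (\<Sum>e\<in>F. N e) = D"
    using assms
  proof (induction F arbitrary: D rule: finite_induct)
    case (insert e F)
    then have "size D = Suc (Suc (2 * card F))" by simp
    then obtain a D\<^sub>a where "D = {#a#} + D\<^sub>a" "size D\<^sub>a = Suc (2 * card F)"
      by (rule size_mset_SucE)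
    moreover from this(2) obtain b D' where "D\<^sub>a = {#b#} + D'" "size D' = 2 * card F"
      by (rule size_mset_SucE)
    ultimately have split: "D = {#a, b#} + D'" and "size D' = 2 * card F" by simp_all
    then obtain N where sizes: "\<forall>i\<in>F. size (N i) = 2" and total: "(\<Sum>i\<in>F. N i) = D'"
      using insert.IH by blast
    have "(\<Sum>i\<in>F. (N(e := {#a, b#})) i) = D'"
      unfolding total[symmetric] using insert.hyps(2) by (intro sum.cong) auto
    then show ?case
      using insert.hyps sizes split by (intro exI[of _ "N(e := {#a, b#})"]) auto
  qed simp
  with that show ?thesis by blast
qed

definition add_edges ::
    "('v, 'e) multipole \<Rightarrow> 'e set \<Rightarrow> ('e \<Rightarrow> 'v multiset) \<Rightarrow> ('v, 'e) multipole" where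
  "add_edges K F N = \<lparr>verts = verts K, edges = edges K \<union> F,
     ends = (\<lambda>e. if e \<in> F then N e else ends K e)\<rparr>"

lemma degree_add_edges:
  assumes "finite (edges K)" "finite F" "edges K \<inter> F = {}"
  shows "degree (add_edges K F N) x = degree K x + count (\<Sum>e\<in>F. N e) x"
proof -
  have "degree (add_edges K F N) x = (\<Sum>e\<in>edges K. count (ends (add_edges K F N) e) x) +
      (\<Sum>e\<in>F. count (ends (add_edges K F N) e) x)"
    using assms by (simp add: degree_def add_edges_def sum.union_disjoint)
  moreover have "(\<Sum>e\<in>edges K. count (ends (add_edges K F N) e) x) = degree K x"
    unfolding degree_def using assms(3) by (intro sum.cong) (auto simp: add_edges_def)
  ultimately show ?thesis by (simp add: add_edges_def count_sum)
qed

lemma completes_add_edges: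
  assumes "graph K" "finite F" "edges K \<inter> F = {}"
    and "\<And>e. e \<in> F \<Longrightarrow> size (N e) = 2" "set_mset (\<Sum>e\<in>F. N e) \<subseteq> verts K"
    and "\<And>x. x \<in> verts K \<Longrightarrow> degree K x + count (\<Sum>e\<in>F. N e) x = 3"
  shows "completes (add_edges K F N) K"
proof -
  have "set_mset (N e) \<subseteq> verts K" if "e \<in> F" for e
    using assms(2,5) that by (auto simp: set_mset_sum)
  then have "graph (add_edges K F N)"
    using assms(1,2,4) by (auto simp: graph_def add_edges_def)
  moreover have "degree (add_edges K F N) x = 3" if "x \<in> verts K" for x
    using assms(1-3) assms(6)[OF that] by (simp add: degree_add_edges graph_def)
  ultimately show ?thesis
    using assms(3) by (auto simp: completes_def cubic_graph_def add_edges_def)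
qed

lemma cubic_completion:
  assumes "graph K" "\<And>x. x \<in> verts K \<Longrightarrow> degree K x \<le> 3" "even (card (verts K))"
    and edge_names: "finite E" "edges K \<subseteq> E" "3 * card (verts K) \<le> 2 * card E"
  obtains H where "completes H K" "verts H = verts K"
proof -
  have finite: "finite (verts K)" "finite (edges K)" using assms(1) by (auto simp: graph_def)
  define missing where "missing = (\<Sum>x\<in>verts K. replicate_mset (3 - degree K x) x)"
  have "count missing x = 3 - degree K x" if "x \<in> verts K" for x
    using that finite(1) by (simp add: missing_def count_sum)
  then have degree: "degree K x + count missing x = 3" if "x \<in> verts K" for x
    using assms(2)[OF that] that by simp
  have "size missing + (\<Sum>x\<in>verts K. degree K x) = (\<Sum>x\<in>verts K. 3)"
    using assms(2) by (simp add: missing_def flip: sum.distrib)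
  then have size: "size missing + 2 * card (edges K) = 3 * card (verts K)"
    using graph_sum_degree_in[OF assms(1)] by (simp add: degree_eq_degree_in)
  then have "even (size missing)" using assms(3) by presburger
  then obtain n where pairs: "size missing = 2 * n" by blast
  then have "n \<le> card (E - edges K)"
    using size edge_names by (simp add: card_Diff_subset finite(2))
  then obtain F where F: "F \<subseteq> E - edges K" "card F = n" "finite F"
    using obtain_subset_with_card_n by blast
  then obtain N where sizes: "\<And>e. e \<in> F \<Longrightarrow> size (N e) = 2" and total: "(\<Sum>e\<in>F. N e) = missing"
    using mset_partition_pairs pairs by blast
  have "completes (add_edges K F N) K"
  proof (rule completes_add_edges[OF assms(1) F(3) _ sizes])
    show "set_mset (\<Sum>e\<in>F. N e) \<subseteq> verts K"
      using finite(1) by (auto simp: total missing_def set_mset_sum)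
  qed (use F(1) degree total in auto)
  then show ?thesis by (rule that) (simp add: add_edges_def)
qed

lemma degree_submultipole_le:
  assumes "finite (edges M)" "submultipole K M"
  shows "degree K x \<le> degree M x"
proof -
  have "degree K x = degree_in M (edges K) x"
    using assms(2) by (simp add: degree_def degree_in_def submultipole_def)
  also have "\<dots> \<le> degree M x"
    using assms unfolding degree_eq_degree_in
    by (intro degree_in_mono) (auto simp: submultipole_def)
  finally show ?thesis .
qed

lemma ex_smaller_completion_iff:
  assumes G: "cubic_graph G" and K: "graph K" "submultipole K G"
  shows "(\<exists>H. completes H K \<and> card (verts H) < card (verts G)) \<longleftrightarrow>
    card (verts K) + 2 \<le> card (verts G)"
proof
  assume "\<exists>H. completes H K \<and> card (verts H) < card (verts G)"
  then obtain H where "completes H K" and smaller: "card (verts H) < card (verts G)" by blast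
  then have "cubic_graph H" "verts K \<subseteq> verts H" by (simp_all add: completes_def)
  then have "card (verts K) \<le> card (verts H)"
    by (intro card_mono) (auto simp: cubic_graph_def graph_def)
  moreover have "even (card (verts H))" "even (card (verts G))"
    using G \<open>cubic_graph H\<close> by (simp_all add: cubic_graph_even_card)
  ultimately show "card (verts K) + 2 \<le> card (verts G)" using smaller by presburger
next
  assume room: "card (verts K) + 2 \<le> card (verts G)"
  have finite: "finite (edges G)" "finite (verts K)"
    using G K(1) by (auto simp: cubic_graph_def graph_def)
  have "\<not> verts G \<subseteq> verts K" using room card_mono[OF finite(2), of "verts G"] by auto
  then obtain w where "w \<in> verts G" "w \<notin> verts K" by blast
  define V where "V = (if even (card (verts K)) then verts K else insert w (verts K))"
  have V: "verts K \<subseteq> V" "V \<subseteq> verts G" "finite V" "even (card V)" "card V < card (verts G)"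
    using room K(2) finite(2) \<open>w \<in> verts G\<close> \<open>w \<notin> verts K\<close>
    by (auto simp: V_def submultipole_def)
  let ?K = "K\<lparr>verts := V\<rparr>"
  have "submultipole ?K G" using K(2) V(2) by (simp add: submultipole_def)
  obtain H where H: "completes H ?K" "verts H = V"
  proof (rule cubic_completion[of ?K "edges G"])
    show "graph ?K" using K(1) V(1,3) by (auto simp: graph_def)
    show "degree ?K x \<le> 3" if "x \<in> verts ?K" for x
      using degree_submultipole_le[OF finite(1) \<open>submultipole ?K G\<close>, of x] G V(2) that
      by (auto simp: cubic_graph_def subset_iff)
    show "3 * card (verts ?K) \<le> 2 * card (edges G)"
      using cubic_graph_card[OF G] V(5) by simp
  qed (use V(4) finite(1) K(2) in \<open>auto simp: submultipole_def\<close>)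
  have "completes H K" using H(1) V(1) by (auto simp: completes_def)
  with H(2) V(5) show "\<exists>H. completes H K \<and> card (verts H) < card (verts G)" by blast
qed

subsection \<open>Irreducibility\<close>

lemma component_remove_edges:
  assumes "graph G" "K \<in> components (remove_edges G S)"
  shows "graph K" "submultipole K G"
proof -
  have "graph (remove_edges G S)" using assms(1) by (auto simp: graph_def remove_edges_def)
  then show "graph K" using assms(2) by (rule graph_component)
  show "submultipole K G"
    using components_submultipole[OF assms(2)] by (auto simp: submultipole_def remove_edges_def)
qed

lemma cubic_graph_edges_psubset:
  assumes "cubic_graph G" "graph K" "submultipole K G" "verts K \<noteq> verts G"
  shows "edges K \<subset> edges G"
proof -
  obtain x where "x \<in> verts G" "x \<notin> verts K"
    using assms(3,4) by (auto simp: submultipole_def)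
  then have "degree_in G (edges G) x \<noteq> 0"
    using assms(1) by (simp add: cubic_graph_def degree_eq_degree_in)
  then obtain e where "e \<in> edges G" "x \<in># ends G e"
    using degree_in_eq_0[of "edges G" x G] by auto
  moreover from this(2) have "e \<notin> edges K"
    using assms(2,3) \<open>x \<notin> verts K\<close> by (auto simp: graph_def submultipole_def)
  ultimately show ?thesis using assms(3) by (auto simp: submultipole_def)
qed

lemma submultipole_remove_verts:
  assumes "graph K" "submultipole K G" "verts K \<inter> X = {}"
  shows "submultipole K (remove_verts G X)"
proof -
  have "ends K e = filter_mset (\<lambda>x. x \<notin> X) (ends K e)" if "e \<in> edges K" for e
    using assms(1,3) that by (auto simp: graph_def filter_mset_eq_conv eq_commute[of "ends K e"])
  then show ?thesis
    using assms(2,3) by (auto simp: submultipole_def remove_verts_def)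
qed

lemma edge_colourable_iff_chromatic_index_le:
  "edge_colourable k M \<longleftrightarrow> chromatic_index M \<le> enat k"
proof
  assume "edge_colourable k M"
  then show "chromatic_index M \<le> enat k"
    unfolding chromatic_index_def by (intro Inf_lower) auto
next
  assume index_le: "chromatic_index M \<le> enat k"
  show "edge_colourable k M"
  proof (rule ccontr)
    assume "\<not> edge_colourable k M"
    then have "Suc k \<le> j" if "edge_colourable j M" for j
      using edge_colourable_mono[OF that, of k M] by (fastforce simp: submultipole_def)
    then have "enat (Suc k) \<le> chromatic_index M"
      unfolding chromatic_index_def by (intro Inf_greatest) auto
    with index_le have "enat (Suc k) \<le> enat k" by (rule order_trans[rotated])
    then show False by simp
  qed
qed

lemma chromatic_index_proper_submultipole:
  assumes G: "cubic_graph G" "connected G" and K: "submultipole K G" "edges K \<subset> edges G"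
    and uncolourable: "\<not> edge_colourable 3 K"
  shows "chromatic_index K \<in> {4, \<infinity>}"
proof (cases "\<forall>e\<in>edges K. \<forall>x. count (ends K e) x \<le> 1")
  case True
  have "edge_colourable (2 * 3 - 2) (G\<lparr>edges := edges K\<rparr>)"
    using G K True
    by (intro edge_colourable_proper_edge_subset) (auto simp: cubic_graph_def submultipole_def)
  then have "edge_colourable 4 K"
    by (rule edge_colourable_mono) (use K(1) in \<open>auto simp: submultipole_def\<close>)
  with uncolourable have "chromatic_index K \<le> enat 4" "\<not> chromatic_index K \<le> enat 3"
    by (simp_all add: edge_colourable_iff_chromatic_index_le)
  then have "chromatic_index K = enat 4" by (cases "chromatic_index K") auto
  then show ?thesis by (simp add: numeral_eq_enat)
next
  case False
  then have "\<not> edge_colourable k K" for k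
    by (auto simp: edge_colourable_def proper_edge_colouring_def)
  then have "\<not> chromatic_index K \<le> enat k" for k
    by (simp add: edge_colourable_iff_chromatic_index_le)
  then have "chromatic_index K = \<infinity>" by (cases "chromatic_index K") auto
  then show ?thesis by simp
qed

lemma k_irreducible_imp_remove_verts_colourable:
  assumes G: "cubic_graph G" "connected G" and irreducible: "k_irreducible k G"
    and X: "X \<subseteq> verts G" "2 \<le> card X" "3 * card X < k"
  shows "edge_colourable 3 (remove_verts G X)"
proof (rule ccontr)
  assume uncolourable: "\<not> edge_colourable 3 (remove_verts G X)"
  have "graph G" and degree: "\<And>x. x \<in> verts G \<Longrightarrow> degree G x = 3"
    and finite: "finite (verts G)" "finite (edges G)" "finite X"
    using G(1) X(1) by (auto simp: cubic_graph_def graph_def intro: finite_subset)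
  define S where "S = incident_edges G (edges G) X"
  obtain K where K: "K \<in> components (remove_edges G S)" "\<not> edge_colourable 3 K"
    and disjoint: "verts K \<inter> X = {}"
    using ex_uncolourable_component[OF \<open>graph G\<close> _ _ uncolourable] degree by (auto simp: S_def)
  have "graph K" "submultipole K G" using component_remove_edges[OF \<open>graph G\<close> K(1)] .
  have "card (verts K) + card X = card (verts K \<union> X)"
    using disjoint \<open>graph K\<close> finite(3) by (simp add: card_Un_disjoint graph_def)
  also have "\<dots> \<le> card (verts G)"
    using \<open>submultipole K G\<close> X(1) finite(1) by (intro card_mono) (auto simp: submultipole_def)
  finally have room: "card (verts K) + 2 \<le> card (verts G)" using X(2) by simp
  have "card S \<le> (\<Sum>x\<in>X. degree_in G (edges G) x)"
    unfolding S_def using finite(2,3) by (rule card_incident_edges_le)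
  also have "\<dots> = 3 * card X"
    using X(1) degree by (auto simp: subset_iff simp flip: degree_eq_degree_in)
  finally have "card S < k" using X(3) by simp
  moreover have "S \<subseteq> edges G" by (auto simp: S_def incident_edges_def)
  moreover have "edges K \<subset> edges G"
    using room by (intro cubic_graph_edges_psubset[OF G(1) \<open>graph K\<close> \<open>submultipole K G\<close>]) auto
  then have "chromatic_index K \<in> {4, \<infinity>}"
    using K(2) by (intro chromatic_index_proper_submultipole[OF G \<open>submultipole K G\<close>])
  moreover have "\<exists>H. completes H K \<and> card (verts H) < card (verts G)"
    using room by (simp add: ex_smaller_completion_iff[OF G(1) \<open>graph K\<close> \<open>submultipole K G\<close>])
  ultimately show False
    using irreducible K(1) unfolding k_irreducible_def by blast
qed

lemma k_irreducible_7_imp_bicritical: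
  assumes "cubic_graph G" "connected G" "k_irreducible 7 G"
  shows "bicritical G"
  using k_irreducible_imp_remove_verts_colourable[OF assms]
  by (auto simp: bicritical_def)

lemma card_ge_2_imp_ex_distinct:
  assumes "2 \<le> card A"
  shows "\<exists>u v. u \<in> A \<and> v \<in> A \<and> u \<noteq> v"
  using assms by (metis card_2_iff' obtain_subset_with_card_n subsetD)

lemma bicritical_imp_irreducible:
  assumes G: "cubic_graph G" and bicritical: "bicritical G"
  shows "irreducible G"
proof -
  have "\<not> (\<exists>H. completes H K \<and> card (verts H) < card (verts G))"
    if K: "K \<in> components (remove_edges G S)" and index: "chromatic_index K \<in> {4, \<infinity>}" for S K
  proof
    have "graph G" using G by (simp add: cubic_graph_def)
    then have "graph K" "submultipole K G" using component_remove_edges K by blast+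
    then have "finite (verts K)" "verts K \<subseteq> verts G"
      by (simp_all add: graph_def submultipole_def)
    assume "\<exists>H. completes H K \<and> card (verts H) < card (verts G)"
    then have "card (verts K) + 2 \<le> card (verts G)"
      using ex_smaller_completion_iff[OF G \<open>graph K\<close> \<open>submultipole K G\<close>] by blast
    then have "2 \<le> card (verts G - verts K)"
      by (simp add: card_Diff_subset \<open>finite (verts K)\<close> \<open>verts K \<subseteq> verts G\<close>)
    then obtain u v where uv: "u \<in> verts G - verts K" "v \<in> verts G - verts K" "u \<noteq> v"
      using card_ge_2_imp_ex_distinct by blast
    with bicritical have "edge_colourable 3 (remove_verts G {u, v})"
      by (auto simp: bicritical_def)
    moreover have "submultipole K (remove_verts G {u, v})"
      using \<open>graph K\<close> \<open>submultipole K G\<close> uv by (intro submultipole_remove_verts) auto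
    ultimately have "edge_colourable 3 K" by (rule edge_colourable_mono[OF _ order_refl])
    with index show False
      by (auto simp: edge_colourable_iff_chromatic_index_le numeral_eq_enat)
  qed
  then show ?thesis unfolding irreducible_def k_irreducible_def by blast
qed

theorem theorem5:
  fixes G :: "('v, 'e) multipole"
  assumes "snark G"
  shows "(bicritical G \<longleftrightarrow> four_vertex_critical G) \<and>
         (four_vertex_critical G \<longleftrightarrow> k_irreducible 7 G) \<and>
         (k_irreducible 7 G \<longleftrightarrow> irreducible G)"
proof -
  have G: "cubic_graph G" "connected G" using assms by (simp_all add: snark_def)
  have "bicritical G \<longleftrightarrow> four_vertex_critical G"
    by (rule bicritical_iff_four_vertex_critical[OF G(1)])
  moreover have "bicritical G \<Longrightarrow> irreducible G"
    by (rule bicritical_imp_irreducible[OF G(1)])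
  moreover have "irreducible G \<Longrightarrow> k_irreducible 7 G" by (simp add: irreducible_def)
  moreover have "k_irreducible 7 G \<Longrightarrow> bicritical G"
    by (rule k_irreducible_7_imp_bicritical[OF G])
  ultimately show ?thesis by blast
qed

end
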